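(* Let $\mathbf{k}$ be a local field of characteristic zero and let $n,D\geq 2$ be integers. Let $(f_m)_{m\in\mathbb{N}}$ be a sequence of elements of $\mathrm{Bir}(\mathbb{P}^n_{\mathbf{k}})$ such that $\mathrm{ord}(f_m)\leq D$ for all $m\gg 0$ and such that $(f_m)_m$ converges to $\mathrm{id}\in\mathrm{Bir}(\mathbb{P}^n_{\mathbf{k}})$ in the Euclidean topology. Then $f_m=\mathrm{id}$ for all $m\gg0$.
   Context: A local field is a field that is locally compact with respect to a non-discrete topology. $\mathrm{Bir}(\mathbb{P}^n_{\mathbf{k}})$ is the group of birational transformations of $\mathbb{P}^n_{\mathbf{k}}$ and $\mathrm{ord}(f)$ denotes the order of $f$ in this group. Euclidean topology: for $d\geq1$, let $W_d(\mathbf{k})$ be the projective space of equivalence classes $[h_0:\dots:h_n]$ of non-zero $(n+1)$-tuples of homogeneous polynomials of degree $d$ in $\mathbf{k}[x_0,\dots,x_n]$ modulo multiplication by $\lambda\in\mathbf{k}^*$; let $H_d(\mathbf{k})\subset W_d(\mathbf{k})$ be the subset of those $h$ for which the rational map $\psi_h\colon[x_0:\dots:x_n]\dashrightarrow[h_0(x):\dots:h_n(x)]$ is birational, and $\pi_d\colon H_d(\mathbf{k})\to\mathrm{Bir}(\mathbb{P}^n_{\mathbf{k}})$, $h\mapsto\psi_h$; its image is the set $\mathrm{Bir}(\mathbb{P}^n_{\mathbf{k}})_{\leq d}$ of maps of degree $\leq d$. Give $W_d(\mathbf{k})$ the topology induced by the topology of $\mathbf{k}$, $H_d(\mathbf{k})$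 the subspace topology, $\mathrm{Bir}(\mathbb{P}^n_{\mathbf{k}})_{\leq d}$ the quotient topology via $\pi_d$, and $\mathrm{Bir}(\mathbb{P}^n_{\mathbf{k}})$ the inductive limit topology of the inclusions $\mathrm{Bir}(\mathbb{P}^n_{\mathbf{k}})_{\leq d}\hookrightarrow\mathrm{Bir}(\mathbb{P}^n_{\mathbf{k}})_{\leq d+1}$ (a set is closed iff its intersection with every $\mathrm{Bir}(\mathbb{P}^n_{\mathbf{k}})_{\leq d}$ is closed there). *)

theory Defs
  imports "HOL-Analysis.Analysis"
begin

text \<open>A local field: a Hausdorff topological field (field operations continuous)
  which is locally compact and not discrete. Characteristic zero is imposed
  via the type class field_char_0 in the statement.\<close>

definition local_field :: "'k::{field, t2_space} itself \<Rightarrow> bool" where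
  "local_field _ \<longleftrightarrow>
     continuous_on UNIV (\<lambda>p::'k \<times> 'k. fst p + snd p) \<and>
     continuous_on UNIV (\<lambda>p::'k \<times> 'k. fst p * snd p) \<and>
     continuous_on UNIV (\<lambda>x::'k. - x) \<and>
     continuous_on (UNIV - {0}) (\<lambda>x::'k. inverse x) \<and>
     locally_compact_space (euclidean :: 'k topology) \<and>
     \<not> (\<forall>x::'k. open {x})"

definition mons :: "nat \<Rightarrow> nat \<Rightarrow> (nat \<Rightarrow> nat) set" where
  "mons n d = {\<alpha>. (\<forall>j>n. \<alpha> j = 0) \<and> (\<Sum>j\<le>n. \<alpha> j) = d}"

text \<open>Index set of coefficients of an (n+1)-tuple (h_0,...,h_n) of degree-d forms.\<close>
definition idx :: "nat \<Rightarrow> nat \<Rightarrow> (nat \<times> (nat \<Rightarrow> nat)) set" where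
  "idx n d = {..n} \<times> mons n d"

type_synonym 'k coeffs = "nat \<times> (nat \<Rightarrow> nat) \<Rightarrow> 'k"

definition coeff_top :: "nat \<Rightarrow> nat \<Rightarrow> ('k::topological_space) coeffs topology" where
  "coeff_top n d = product_topology (\<lambda>_. euclidean) (idx n d)"

definition peval :: "nat \<Rightarrow> nat \<Rightarrow> ('k::comm_ring_1) coeffs \<Rightarrow> nat \<Rightarrow> (nat \<Rightarrow> 'k) \<Rightarrow> 'k" where
  "peval n d c i x = (\<Sum>\<alpha>\<in>mons n d. c (i, \<alpha>) * (\<Prod>j\<le>n. x j ^ \<alpha> j))"

definition pmap :: "nat \<Rightarrow> nat \<Rightarrow> ('k::comm_ring_1) coeffs \<Rightarrow> (nat \<Rightarrow> 'k) \<Rightarrow> (nat \<Rightarrow> 'k)" where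
  "pmap n d c x = (\<lambda>i. if i \<le> n then peval n d c i x else 0)"

text \<open>A map F of polynomial tuples induces the identity rational map of P^n:
  F is not identically zero and F(x) is proportional to x (F_i x_j = F_j x_i).\<close>
definition is_id_fun :: "nat \<Rightarrow> ((nat \<Rightarrow> 'k) \<Rightarrow> (nat \<Rightarrow> 'k::comm_ring_1)) \<Rightarrow> bool" where
  "is_id_fun n F \<longleftrightarrow> (\<exists>x. \<exists>i\<le>n. F x i \<noteq> 0) \<and>
     (\<forall>x i j. i \<le> n \<longrightarrow> j \<le> n \<longrightarrow> F x i * x j = F x j * x i)"

definition birational :: "nat \<Rightarrow> nat \<Rightarrow> ('k::comm_ring_1) coeffs \<Rightarrow> bool" where
  "birational n d c \<longleftrightarrow>
     (\<exists>e g. g \<in> extensional (idx n e) \<and>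
        is_id_fun n (pmap n e g \<circ> pmap n d c) \<and> is_id_fun n (pmap n d c \<circ> pmap n e g))"

text \<open>The set \<^emph>\<open>H_d(k)\<close> (lifted to coefficient tuples, which are taken up to scalars below).\<close>
definition Hset :: "nat \<Rightarrow> nat \<Rightarrow> ('k::{comm_ring_1}) coeffs set" where
  "Hset n d = {c \<in> PiE (idx n d) (\<lambda>_. UNIV). birational n d c}"

definition same_map :: "nat \<Rightarrow> nat \<Rightarrow> ('k::comm_ring_1) coeffs \<Rightarrow> nat \<Rightarrow> 'k coeffs \<Rightarrow> bool" where
  "same_map n d c e c' \<longleftrightarrow>
     (\<forall>x i j. i \<le> n \<longrightarrow> j \<le> n \<longrightarrow> peval n d c i x * peval n e c' j x = peval n d c j x * peval n e c' i x)"

text \<open>psi_h: the birational map defined by h, as the class of all its representatives.\<close>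
definition psi :: "nat \<Rightarrow> nat \<Rightarrow> ('k::comm_ring_1) coeffs \<Rightarrow> (nat \<times> 'k coeffs) set" where
  "psi n d c = {(e, c'). 1 \<le> e \<and> c' \<in> Hset n e \<and> same_map n d c e c'}"

definition Bir :: "nat \<Rightarrow> (nat \<times> ('k::comm_ring_1) coeffs) set set" where
  "Bir n = {psi n d c | d c. 1 \<le> d \<and> c \<in> Hset n d}"

definition id_coeffs :: "nat \<Rightarrow> ('k::comm_ring_1) coeffs" where
  "id_coeffs n = restrict (\<lambda>(i, \<alpha>). if \<alpha> = (\<lambda>j. if j = i then 1 else 0) then 1 else 0) (idx n 1)"

definition bir_id :: "nat \<Rightarrow> (nat \<times> ('k::comm_ring_1) coeffs) set" where
  "bir_id n = psi n 1 (id_coeffs n)"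

definition bir_pow_is_id :: "nat \<Rightarrow> (nat \<times> ('k::comm_ring_1) coeffs) set \<Rightarrow> nat \<Rightarrow> bool" where
  "bir_pow_is_id n f k \<longleftrightarrow> (\<exists>d c. (d, c) \<in> f \<and> is_id_fun n ((pmap n d c) ^^ k))"

definition bir_ord_le :: "nat \<Rightarrow> (nat \<times> ('k::comm_ring_1) coeffs) set \<Rightarrow> nat \<Rightarrow> bool" where
  "bir_ord_le n f D \<longleftrightarrow> (\<exists>k. 0 < k \<and> k \<le> D \<and> bir_pow_is_id n f k)"

text \<open>Euclidean topology on Bir(P^n): final topology with respect to all
  H_d \<rightarrow> Bir(P^n)_{\<le>d} \<subseteq> Bir(P^n) (inductive limit of quotient topologies).\<close>
definition bir_topology :: "nat \<Rightarrow> (nat \<times> ('k::{comm_ring_1, topological_space}) coeffs) set topology" where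
  "bir_topology n = topology (\<lambda>U. U \<subseteq> Bir n \<and>
     (\<forall>d\<ge>1. openin (subtopology (coeff_top n d) (Hset n d)) {c \<in> Hset n d. psi n d c \<in> U}))"

end

(* The set of maps f with f = id or ord(f) > D is an open neighbourhood of id.  Triviality of
   the k-th iterate is an equality of polynomial expressions at each point, hence a closed
   condition on the coefficients.  Suppose the coefficients of f tend to those of a representative
   of id and f^k = id.  Fix a point p of an affine chart at which the limit is defined and put
   v_m = f^(m+1)(p) - f^m(p).  Since f - id has small difference quotients, v_m = v_0 + o(v_0),
   while v_0 + ... + v_(k-1) = 0.  In characteristic zero this gives v_0 = o(v_0), so f(p) = p once
   f is close enough to id.  Because the degree is fixed, it suffices to do this for the points p
   of a finite grid, and f = id follows.  *)

theory Submission
  imports Defs "HOL-Computational_Algebra.Polynomial"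
begin

text \<open>The terms of the sequence come without converging lifts of one common degree, so the
  argument runs over the neighbourhood filters of tuples in each \<open>Hset n d\<close>. In degree
  d the identity is represented by the tuples (h x_0, ..., h x_n) with h a nonzero form of degree d
  - 1. Where h vanishes the limit tuple is zero and the dynamical argument says nothing; such points
  are absorbed by a polynomial factor that is cancelled at the end. The displacement v_m is a
  vector, and without an absolute value no coordinate can be singled out as dominant. Hence o(v) is
  read as a linear combination of all coordinates of v with coefficients tending to 0, and v = o(v)
  forces v = 0 by eliminating the coordinates one after the other.\<close>

section \<open>Polynomial functions\<close>

text \<open>\<open>N\<close> bounds the degree in each variable separately; this suffices for vanishing on a grid.\<close>
definition polyfun :: "nat \<Rightarrow> nat \<Rightarrow> ((nat \<Rightarrow> 'k::field_char_0) \<Rightarrow> 'k) \<Rightarrow> bool" where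
  "polyfun n N Q \<longleftrightarrow> (\<forall>x y. (\<forall>j\<le>n. x j = y j) \<longrightarrow> Q x = Q y) \<and>
     (\<forall>x. \<forall>j\<le>n. \<exists>p. degree p \<le> N \<and> (\<forall>t. Q (x(j := t)) = poly p t))"

lemma polyfun_cong: "polyfun n N Q \<Longrightarrow> (\<And>j. j \<le> n \<Longrightarrow> x j = y j) \<Longrightarrow> Q x = Q y"
  unfolding polyfun_def by blast

lemma polyfun_polyE:
  assumes "polyfun n N Q" "j \<le> n"
  obtains p where "degree p \<le> N" "\<And>t. Q (x(j := t)) = poly p t"
  using assms unfolding polyfun_def by metis

lemma polyfun_const: "polyfun n 0 (\<lambda>x. a)"
  unfolding polyfun_def
  by (auto intro: exI[of _ "[:a:]"])

lemma polyfun_coord: "i \<le> n \<Longrightarrow> polyfun n 1 (\<lambda>x. x i)"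
  unfolding polyfun_def
proof (intro conjI allI impI)
  fix x :: "nat \<Rightarrow> 'a" and j
  show "\<exists>p. degree p \<le> 1 \<and> (\<forall>t. (x(j := t)) i = poly p t)"
    by (cases "i = j") (auto intro: exI[of _ "[:0, 1:]"] exI[of _ "[:x i:]"])
qed auto

lemma polyfun_mono: "polyfun n N Q \<Longrightarrow> N \<le> M \<Longrightarrow> polyfun n M Q"
  unfolding polyfun_def by (meson order_trans)

lemma polyfun_add:
  assumes "polyfun n N P" "polyfun n N Q"
  shows "polyfun n N (\<lambda>x. P x + Q x)"
  unfolding polyfun_def
proof (intro conjI allI impI)
  fix x y :: "nat \<Rightarrow> 'a" assume "\<forall>j\<le>n. x j = y j"
  then show "P x + Q x = P y + Q y"
    using polyfun_cong[OF assms(1), of x y] polyfun_cong[OF assms(2), of x y] by simp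
next
  fix x :: "nat \<Rightarrow> 'a" and j assume j: "j \<le> n"
  obtain p where "degree p \<le> N" "\<And>t. P (x(j := t)) = poly p t"
    using polyfun_polyE[OF assms(1) j] by metis
  moreover obtain q where "degree q \<le> N" "\<And>t. Q (x(j := t)) = poly q t"
    using polyfun_polyE[OF assms(2) j] by metis
  ultimately show "\<exists>p. degree p \<le> N \<and> (\<forall>t. P (x(j := t)) + Q (x(j := t)) = poly p t)"
    by (intro exI[of _ "p + q"]) (auto intro: degree_add_le)
qed

lemma polyfun_mult:
  assumes "polyfun n N P" "polyfun n M Q"
  shows "polyfun n (N + M) (\<lambda>x. P x * Q x)"
  unfolding polyfun_def
proof (intro conjI allI impI)
  fix x y :: "nat \<Rightarrow> 'a" assume "\<forall>j\<le>n. x j = y j"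
  then show "P x * Q x = P y * Q y"
    using polyfun_cong[OF assms(1), of x y] polyfun_cong[OF assms(2), of x y] by simp
next
  fix x :: "nat \<Rightarrow> 'a" and j assume j: "j \<le> n"
  obtain p where p: "degree p \<le> N" "\<And>t. P (x(j := t)) = poly p t"
    using polyfun_polyE[OF assms(1) j] by metis
  obtain q where q: "degree q \<le> M" "\<And>t. Q (x(j := t)) = poly q t"
    using polyfun_polyE[OF assms(2) j] by metis
  have "degree (p * q) \<le> N + M"
    using degree_mult_le[of p q] p(1) q(1) by linarith
  then show "\<exists>p. degree p \<le> N + M \<and> (\<forall>t. P (x(j := t)) * Q (x(j := t)) = poly p t)"
    using p q by (intro exI[of _ "p * q"]) auto
qed

lemma polyfun_diff:
  assumes "polyfun n N P" "polyfun n N Q"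
  shows "polyfun n N (\<lambda>x. P x - Q x)"
  using polyfun_add[OF assms(1) polyfun_mult[OF polyfun_const[of n "-1"] assms(2), simplified]]
  by simp

lemma polyfun_sum:
  assumes "\<And>a. a \<in> A \<Longrightarrow> polyfun n N (f a)"
  shows "polyfun n N (\<lambda>x. \<Sum>a\<in>A. f a x)"
  using assms
  by (induction A rule: infinite_finite_induct)
     (auto intro: polyfun_add polyfun_mono[OF polyfun_const])

lemma polyfun_prod:
  assumes "\<And>a. a \<in> A \<Longrightarrow> polyfun n (N a) (f a)"
  shows "polyfun n (\<Sum>a\<in>A. N a) (\<lambda>x. \<Prod>a\<in>A. f a x)"
  using assms
  by (induction A rule: infinite_finite_induct) (auto intro: polyfun_const polyfun_mult)

lemma polyfun_power: "polyfun n N Q \<Longrightarrow> polyfun n (k * N) (\<lambda>x. Q x ^ k)"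
  by (induction k) (auto intro: polyfun_const polyfun_mult)

lemma polyfun_peval_compose:
  assumes "\<And>j. j \<le> n \<Longrightarrow> polyfun n M (\<lambda>x. Y x j)"
  shows "polyfun n (d * M) (\<lambda>x. peval n d c i (Y x))"
  unfolding peval_def
proof (rule polyfun_sum)
  fix \<alpha> assume "\<alpha> \<in> mons n d"
  then have "(\<Sum>j\<le>n. \<alpha> j * M) = d * M"
    by (simp add: mons_def flip: sum_distrib_right)
  moreover have "polyfun n (\<Sum>j\<le>n. \<alpha> j * M) (\<lambda>x. \<Prod>j\<le>n. Y x j ^ \<alpha> j)"
    using assms by (intro polyfun_prod polyfun_power) auto
  ultimately show "polyfun n (d * M) (\<lambda>x. c (i, \<alpha>) * (\<Prod>j\<le>n. Y x j ^ \<alpha> j))"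
    using polyfun_mult[OF polyfun_const] by fastforce
qed

lemma polyfun_peval: "polyfun n d (peval n d c i)"
  using polyfun_peval_compose[of n 1 "\<lambda>x. x" d c i, OF polyfun_coord] by simp

lemma pmap_iterate_Suc:
  "i \<le> n \<Longrightarrow> (pmap n d c ^^ Suc k) x i = peval n d c i ((pmap n d c ^^ k) x)"
  by (simp add: pmap_def[of n d c "(pmap n d c ^^ k) x"])

lemma polyfun_iterate:
  assumes "i \<le> n" shows "\<exists>N. polyfun n N (\<lambda>x. (pmap n d c ^^ k) x i)"
proof -
  have "\<exists>N. \<forall>i\<le>n. polyfun n N (\<lambda>x. (pmap n d c ^^ k) x i)"
  proof (induction k)
    case 0 then show ?case using polyfun_coord[of _ n] by auto
  next
    case (Suc k)
    then obtain N where N: "\<And>i. i \<le> n \<Longrightarrow> polyfun n N (\<lambda>x. (pmap n d c ^^ k) x i)" by blast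
    show ?case
      using polyfun_peval_compose[of n N "pmap n d c ^^ k", OF N]
      by (auto simp: pmap_iterate_Suc simp del: funpow.simps intro!: exI[of _ "d * N"])
  qed
  then show ?thesis using assms by blast
qed

text \<open>The two witnesses are merged one coordinate at a time: in the current variable both
  restrictions are nonzero polynomials, and an infinite field contains a \<open>t\<close> that is a
  root of neither. So polynomial functions have no zero divisors.\<close>

lemma polyfun_mult_nonzero:
  assumes P: "polyfun n N P" "P x \<noteq> 0" and Q: "polyfun n M Q" "Q y \<noteq> 0"
  shows "\<exists>z. P z * Q z \<noteq> 0"
proof -
  have "\<exists>x y. P x \<noteq> 0 \<and> Q y \<noteq> 0 \<and> (\<forall>j<m. x j = y j)" if "m \<le> Suc n" for m
    using that
  proof (induction m)
    case 0 then show ?case using assms by blast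
  next
    case (Suc m)
    then obtain x y where xy: "P x \<noteq> 0" "Q y \<noteq> 0" "\<forall>j<m. x j = y j" by auto
    have m: "m \<le> n" using Suc by simp
    obtain p where p: "\<And>t. P (x(m := t)) = poly p t"
      using polyfun_polyE[OF P(1) m] by metis
    obtain q where q: "\<And>t. Q (y(m := t)) = poly q t"
      using polyfun_polyE[OF Q(1) m] by metis
    have "p \<noteq> 0" "q \<noteq> 0" using p[of "x m"] q[of "y m"] xy by auto
    then have "finite {t. poly (p * q) t = 0}" by (intro poly_roots_finite) simp
    then obtain t where "poly (p * q) t \<noteq> 0"
      using ex_new_if_finite[OF infinite_UNIV_char_0] by blast
    then have "P (x(m := t)) \<noteq> 0" "Q (y(m := t)) \<noteq> 0" using p q by auto
    moreover have "\<forall>j<Suc m. (x(m := t)) j = (y(m := t)) j" using xy by (simp add: less_Suc_eq)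
    ultimately show ?case by blast
  qed
  from this[of "Suc n"] obtain x y where xy: "P x \<noteq> 0" "Q y \<noteq> 0" "\<forall>j<Suc n. x j = y j" by blast
  have "P x = P y" by (rule polyfun_cong[OF P(1)]) (use xy in auto)
  then show ?thesis using xy by auto
qed

text \<open>This extends an identity proved only where \<open>P\<close> is nonzero to all
  points.\<close>

lemma polyfun_cancel:
  assumes "polyfun n N P" "P x \<noteq> 0" "polyfun n M Q" "\<And>z. P z * Q z = 0"
  shows "Q y = 0"
  using polyfun_mult_nonzero[OF assms(1,2,3)] assms(4) by blast

text \<open>The coordinates are freed from \<open>A\<close> one at a time, since a polynomial of
  degree at most \<open>N\<close> with more than \<open>N\<close> roots is zero. A filter can treat
  only finitely many points at once, and this reduces an identity to finitely many.\<close>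

lemma polyfun_zero_on_grid:
  assumes Q: "polyfun n N Q" and A: "card A > N"
    and zero: "\<And>x. (\<And>j. j \<le> n \<Longrightarrow> x j \<in> A) \<Longrightarrow> Q x = 0"
  shows "Q x = 0"
proof -
  have "\<forall>x. (\<forall>j. m \<le> j \<and> j \<le> n \<longrightarrow> x j \<in> A) \<longrightarrow> Q x = 0" if "m \<le> Suc n" for m
    using that
  proof (induction m)
    case 0 then show ?case using zero by auto
  next
    case (Suc m)
    show ?case
    proof (intro allI impI)
      fix x assume x: "\<forall>j. Suc m \<le> j \<and> j \<le> n \<longrightarrow> x j \<in> A"
      have "m \<le> n" using Suc by simp
      then obtain p where p: "degree p \<le> N" "\<And>t. Q (x(m := t)) = poly p t"
        using polyfun_polyE[OF Q] by metis
      have "poly p t = 0" if "t \<in> A" for t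
        unfolding p(2)[symmetric] using Suc that x by (auto simp: le_less_Suc_eq not_less_eq_eq)
      then have sub: "A \<subseteq> {t. poly p t = 0}" by auto
      have "p = 0"
      proof (rule ccontr)
        assume "p \<noteq> 0"
        then have "card A \<le> degree p"
          using card_mono[OF poly_roots_finite sub] card_poly_roots_bound[of p] by fastforce
        then show False using A p by simp
      qed
      then show "Q x = 0" using p(2)[of "x m"] by simp
    qed
  qed
  from this[of "Suc n"] show ?thesis by auto
qed

section \<open>Rational maps and their representatives\<close>

lemma peval_cong: "(\<And>j. j \<le> n \<Longrightarrow> x j = y j) \<Longrightarrow> peval n d c i x = peval n d c i y"
  unfolding peval_def by (intro sum.cong refl) simp

lemma peval_scale: "peval n d c i (\<lambda>j. s * x j) = s ^ d * peval n d c i x"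
proof -
  have "(\<Prod>j\<le>n. (s * x j) ^ \<alpha> j) = s ^ d * (\<Prod>j\<le>n. x j ^ \<alpha> j)" if "\<alpha> \<in> mons n d" for \<alpha>
    using that by (auto simp: mons_def power_mult_distrib prod.distrib simp flip: power_sum)
  then show ?thesis
    unfolding peval_def sum_distrib_left by (intro sum.cong refl) (simp add: algebra_simps)
qed

lemma peval_scale_cong:
  "(\<And>j. j \<le> n \<Longrightarrow> y j = s * x j) \<Longrightarrow> peval n d c i y = s ^ d * peval n d c i x"
  using peval_cong[of n y "\<lambda>j. s * x j" d c i] by (simp add: peval_scale)

lemma peval_zero:
  assumes "d \<ge> 1" "\<And>j. j \<le> n \<Longrightarrow> x j = 0" shows "peval n d c i x = 0"
  using peval_scale_cong[of n x 0 x d c i] assms by (simp add: power_0_left)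

lemma finite_mons: "finite (mons n d)"
proof (rule finite_subset)
  show "mons n d \<subseteq> {\<alpha>. \<forall>j. (j \<in> {..n} \<longrightarrow> \<alpha> j \<in> {..d}) \<and> (j \<notin> {..n} \<longrightarrow> \<alpha> j = 0)}"
    by (auto simp: mons_def intro: member_le_sum[of _ "{..n}", simplified])
  show "finite {\<alpha>. \<forall>j. (j \<in> {..n} \<longrightarrow> \<alpha> j \<in> {..d}) \<and> (j \<notin> {..n} \<longrightarrow> \<alpha> j = 0)}"
    by (rule finite_set_of_finite_funs) auto
qed

lemma peval_id_coeffs:
  assumes "i \<le> n" shows "peval n 1 (id_coeffs n) i x = x i"
proof -
  let ?e = "\<lambda>j. if j = i then 1 else 0::nat"
  have e: "?e \<in> mons n 1" using assms by (auto simp: mons_def)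
  have "peval n 1 (id_coeffs n) i x
      = (\<Sum>\<alpha>\<in>mons n 1. if \<alpha> = ?e then \<Prod>j\<le>n. x j ^ \<alpha> j else 0)"
    unfolding peval_def id_coeffs_def
    by (intro sum.cong refl) (use assms in \<open>auto simp: idx_def\<close>)
  also have "\<dots> = (\<Prod>j\<le>n. x j ^ ?e j)" using e by (simp add: finite_mons)
  also have "\<dots> = (\<Prod>j\<le>n. if j = i then x j else 1)" by (intro prod.cong) auto
  also have "\<dots> = x i" using assms by simp
  finally show ?thesis .
qed

text \<open>\<open>Hset\<close> does not ask for a nonzero tuple explicitly; the condition is hidden
  in \<open>is_id_fun\<close>, which excludes a zero composite.\<close>

lemma Hset_nonzero:
  assumes "c \<in> Hset n d" obtains x i where "i \<le> n" "peval n d c i x \<noteq> 0"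
proof -
  obtain e g where "is_id_fun n (pmap n d c \<circ> pmap n e g)"
    using assms by (auto simp: Hset_def birational_def)
  then show ?thesis using that unfolding is_id_fun_def pmap_def by fastforce
qed

lemma same_map_sym: "same_map n d c e c' \<Longrightarrow> same_map n e c' d c"
  unfolding same_map_def by (metis mult.commute)

text \<open>Proportionality is transitive only through a nonzero middle tuple, so the component
  \<open>l\<close> of \<open>b\<close> is multiplied in and then cancelled as a polynomial.\<close>

lemma same_map_trans:
  fixes b :: "'k::field_char_0 coeffs"
  assumes ab: "same_map n d a e b" and bc: "same_map n e b f c"
    and b: "l \<le> n" "peval n e b l x \<noteq> 0"
  shows "same_map n d a f c"
  unfolding same_map_def
proof (intro allI impI)
  fix y :: "nat \<Rightarrow> 'k" and i j assume ij: "i \<le> n" "j \<le> n"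
  let ?Q = "\<lambda>x. peval n d a i x * peval n f c j x - peval n d a j x * peval n f c i x"
  have "?Q y = 0"
  proof (rule polyfun_cancel[where P = "peval n e b l" and Q = ?Q])
    show "polyfun n (d + f) ?Q" by (intro polyfun_diff polyfun_mult polyfun_peval)
    fix z
    let ?a = "\<lambda>i. peval n d a i z" and ?b = "\<lambda>i. peval n e b i z" and ?c = "\<lambda>i. peval n f c i z"
    have "?b l * (?a i * ?c j) = ?a l * (?b i * ?c j)"
      using ab ij b(1) unfolding same_map_def by (simp add: algebra_simps)
    also have "\<dots> = ?a l * (?b j * ?c i)" using bc ij unfolding same_map_def by simp
    also have "\<dots> = ?b l * (?a j * ?c i)"
      using ab ij b(1) unfolding same_map_def by (simp add: algebra_simps)
    finally show "?b l * ?Q z = 0" by (simp add: algebra_simps)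
  qed (use b polyfun_peval in auto)
  then show "peval n d a i y * peval n f c j y = peval n d a j y * peval n f c i y" by simp
qed

lemma psi_refl: "1 \<le> d \<Longrightarrow> c \<in> Hset n d \<Longrightarrow> (d, c) \<in> psi n d c"
  by (simp add: psi_def same_map_def)

lemma psi_eq_bir_id_iff:
  fixes c :: "'k::field_char_0 coeffs"
  assumes "1 \<le> d" "c \<in> Hset n d"
  shows "psi n d c = bir_id n \<longleftrightarrow>
    (\<forall>x i j. i \<le> n \<longrightarrow> j \<le> n \<longrightarrow> peval n d c i x * x j = peval n d c j x * x i)"
proof -
  have id: "(\<forall>x i j. i \<le> n \<longrightarrow> j \<le> n \<longrightarrow> peval n d c i x * x j = peval n d c j x * x i)
    \<longleftrightarrow> same_map n d c 1 (id_coeffs n)"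
    unfolding same_map_def by (simp add: peval_id_coeffs[unfolded One_nat_def])
  obtain x l where c: "l \<le> n" "peval n d c l x \<noteq> 0" by (rule Hset_nonzero[OF assms(2)])
  have i: "peval n 1 (id_coeffs n :: 'k coeffs) 0 (\<lambda>_. 1) \<noteq> 0"
    by (simp add: peval_id_coeffs[unfolded One_nat_def])
  show ?thesis unfolding id
  proof
    assume "psi n d c = bir_id n"
    then show "same_map n d c 1 (id_coeffs n)"
      using psi_refl[OF assms] by (auto simp: bir_id_def psi_def intro: same_map_sym)
  next
    assume s: "same_map n d c 1 (id_coeffs n)"
    show "psi n d c = bir_id n"
      using same_map_trans[OF s _ _ i] same_map_trans[OF same_map_sym[OF s] _ c]
      unfolding bir_id_def psi_def by blast
  qed
qed

section \<open>Iterates and the order of a birational map\<close>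

lemma pmap_iterate_scale:
  assumes "i \<le> n" shows "(pmap n d c ^^ k) (\<lambda>j. s * x j) i = s ^ (d ^ k) * (pmap n d c ^^ k) x i"
  using assms
proof (induction k arbitrary: i)
  case (Suc k)
  then show ?case
    using peval_scale_cong[of n "(pmap n d c ^^ k) (\<lambda>j. s * x j)" "s ^ (d ^ k)" "(pmap n d c ^^ k) x"]
    by (simp add: pmap_iterate_Suc mult.commute flip: power_mult del: funpow.simps)
qed simp

lemma pmap_iterate_cong:
  assumes "\<And>j. j \<le> n \<Longrightarrow> x j = y j" "i \<le> n"
  shows "(pmap n d c ^^ k) x i = (pmap n d c ^^ k) y i"
  using assms(2)
proof (induction k arbitrary: i)
  case (Suc k)
  then show ?case
    using peval_cong[of n "(pmap n d c ^^ k) x" "(pmap n d c ^^ k) y"]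
    by (simp add: pmap_iterate_Suc del: funpow.simps)
qed (use assms in simp)

text \<open>A birational map is dominant, so no iterate of it degenerates to the zero tuple.\<close>
lemma Hset_iterate_nonzero:
  fixes c :: "'k::field_char_0 coeffs"
  assumes "c \<in> Hset n d"
  shows "\<exists>x. \<exists>i\<le>n. (pmap n d c ^^ k) x i \<noteq> 0"
proof (induction k)
  case 0 then show ?case by (auto intro!: exI[of _ "\<lambda>_. 1"])
next
  case (Suc k)
  let ?F = "pmap n d c"
  from Suc obtain x i where xi: "i \<le> n" "(?F ^^ k) x i \<noteq> 0" by blast
  obtain e g where id: "is_id_fun n (?F \<circ> pmap n e g)"
    using assms by (auto simp: Hset_def birational_def)
  then obtain y l where yl: "l \<le> n" "?F (pmap n e g y) l \<noteq> 0" by (auto simp: is_id_fun_def)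
  obtain N where N: "polyfun n N (\<lambda>x. (?F ^^ k) x i)" using polyfun_iterate[OF xi(1)] by blast
  have pg: "polyfun n e (\<lambda>x. pmap n e g x j)" if "j \<le> n" for j
    using polyfun_peval that by (simp add: pmap_def)
  have P: "polyfun n (d * e) (\<lambda>x. ?F (pmap n e g x) l)"
    using polyfun_peval_compose[OF pg] yl(1) by (simp add: pmap_def)
  obtain z where z: "?F (pmap n e g z) l * (?F ^^ k) z i \<noteq> 0"
    using polyfun_mult_nonzero[OF P yl(2) N xi(2)] by blast
  \<comment> \<open>The extra factor \<open>w l\<close> permits division by it:
    \<open>F (g w)\<close> is then \<open>r * w\<close> with \<open>r \<noteq> 0\<close>, and
    homogeneity makes the next iterate at \<open>g w\<close> a nonzero multiple of the
    \<open>k\<close>-th one at \<open>w\<close>.\<close>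
  obtain w where w: "w l * (?F (pmap n e g w) l * (?F ^^ k) w i) \<noteq> 0"
    using polyfun_mult_nonzero[OF polyfun_coord[OF yl(1)] _ polyfun_mult[OF P N] z, of "\<lambda>_. 1"] by auto
  define r where "r = ?F (pmap n e g w) l / w l"
  have "?F (pmap n e g w) j = r * w j" if "j \<le> n" for j
    using id that yl(1) w by (auto simp: is_id_fun_def r_def field_simps)
  then have "(?F ^^ k) (?F (pmap n e g w)) i = (?F ^^ k) (\<lambda>j. r * w j) i"
    using xi(1) by (intro pmap_iterate_cong)
  also have "\<dots> = r ^ (d ^ k) * (?F ^^ k) w i" using xi(1) by (rule pmap_iterate_scale)
  also have "\<dots> \<noteq> 0" using w by (simp add: r_def)
  finally have "(?F ^^ Suc k) (pmap n e g w) i \<noteq> 0" by (simp add: funpow_Suc_right del: funpow.simps)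
  then show ?case using xi(1) by blast
qed

text \<open>Only the proportionality half of \<open>is_id_fun\<close>: it is closed in the
  coefficients, while the nonvanishing half is automatic on \<open>Hset\<close>.\<close>

definition iterate_trivial :: "nat \<Rightarrow> nat \<Rightarrow> 'k::comm_ring_1 coeffs \<Rightarrow> nat \<Rightarrow> bool" where
  "iterate_trivial n d c k \<longleftrightarrow> (\<forall>x i j. i \<le> n \<longrightarrow> j \<le> n \<longrightarrow>
     (pmap n d c ^^ k) x i * x j = (pmap n d c ^^ k) x j * x i)"

text \<open>Pointwise induction suffices. If one of the iterates is zero at \<open>x\<close>, both
  sides vanish because \<open>d\<close> and \<open>e\<close> are positive; otherwise the two
  iterates differ by a scalar, which homogeneity pulls out.\<close>

lemma same_map_iterate:
  fixes c c' :: "'k::field_char_0 coeffs"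
  assumes s: "same_map n d c e c'" and de: "1 \<le> d" "1 \<le> e" and "i \<le> n" "j \<le> n"
  shows "(pmap n d c ^^ k) x i * (pmap n e c' ^^ k) x j = (pmap n d c ^^ k) x j * (pmap n e c' ^^ k) x i"
  using assms(4,5)
proof (induction k arbitrary: i j)
  case (Suc k)
  define y where "y = (pmap n d c ^^ k) x"
  define y' where "y' = (pmap n e c' ^^ k) x"
  have yy: "y i * y' j = y j * y' i" if "i \<le> n" "j \<le> n" for i j
    using Suc.IH that by (simp add: y_def y'_def)
  have "peval n d c i y * peval n e c' j y' = peval n d c j y * peval n e c' i y'"
  proof (cases "(\<forall>j\<le>n. y j = 0) \<or> (\<forall>j\<le>n. y' j = 0)")
    case True
    then show ?thesis
    proof
      assume "\<forall>j\<le>n. y j = 0" then show ?thesis by (simp add: peval_zero[OF de(1)])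
    next
      assume "\<forall>j\<le>n. y' j = 0" then show ?thesis by (simp add: peval_zero[OF de(2)])
    qed
  next
    case False
    then obtain l where l: "l \<le> n" "y' l \<noteq> 0" by blast
    define r where "r = y l / y' l"
    have "y j = r * y' j" if "j \<le> n" for j
      using yy[OF l(1) that] l by (simp add: r_def field_simps)
    then have "peval n d c i y = r ^ d * peval n d c i y'" for i by (rule peval_scale_cong)
    then show ?thesis using s Suc.prems by (simp add: same_map_def)
  qed
  then show ?case using Suc.prems by (simp add: pmap_iterate_Suc y_def y'_def del: funpow.simps)
qed simp

text \<open>\<open>bir_pow_is_id\<close> may be witnessed by any representative of the class. Its
  iterate is proportional to that of \<open>c\<close>, and a nonzero component of it is cancelled to
  transfer triviality.\<close>

lemma bir_ord_le_psi_iff: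
  fixes c :: "'k::field_char_0 coeffs"
  assumes "1 \<le> d" "c \<in> Hset n d"
  shows "bir_ord_le n (psi n d c) D \<longleftrightarrow> (\<exists>k. 0 < k \<and> k \<le> D \<and> iterate_trivial n d c k)"
proof -
  have "bir_pow_is_id n (psi n d c) k = iterate_trivial n d c k" for k
  proof (rule iffI[rotated])
    assume "iterate_trivial n d c k"
    then show "bir_pow_is_id n (psi n d c) k"
      using Hset_iterate_nonzero[OF assms(2)] psi_refl[OF assms]
      unfolding bir_pow_is_id_def iterate_trivial_def is_id_fun_def by blast
  next
    assume "bir_pow_is_id n (psi n d c) k"
    then obtain e c' where c': "1 \<le> e" "same_map n d c e c'" "is_id_fun n (pmap n e c' ^^ k)"
      by (auto simp: bir_pow_is_id_def psi_def)
    let ?F = "pmap n d c ^^ k" and ?F' = "pmap n e c' ^^ k"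
    obtain x l where l: "l \<le> n" "?F' x l \<noteq> 0" using c'(3) by (auto simp: is_id_fun_def)
    show "iterate_trivial n d c k"
      unfolding iterate_trivial_def
    proof (intro allI impI)
      fix y :: "nat \<Rightarrow> 'k" and i j assume ij: "i \<le> n" "j \<le> n"
      let ?Q = "\<lambda>x. ?F x i * x j - ?F x j * x i"
      obtain N where N: "polyfun n N (\<lambda>x. ?F' x l)" using polyfun_iterate[OF l(1)] by blast
      obtain A where A: "polyfun n A (\<lambda>x. ?F x i)" using polyfun_iterate[OF ij(1)] by blast
      obtain B where B: "polyfun n B (\<lambda>x. ?F x j)" using polyfun_iterate[OF ij(2)] by blast
      have "?Q y = 0"
      proof (rule polyfun_cancel[where P = "\<lambda>x. ?F' x l" and Q = ?Q, OF N l(2)])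
        show "polyfun n (max A B + 1) ?Q"
          using ij by (intro polyfun_diff polyfun_mult polyfun_coord polyfun_mono[OF A] polyfun_mono[OF B]) auto
        fix z
        have s: "?F z a * ?F' z l = ?F z l * ?F' z a" if "a \<le> n" for a
          using same_map_iterate[OF c'(2) assms(1) c'(1) that l(1)] .
        have t: "?F' z i * z j = ?F' z j * z i" using c'(3) ij by (simp add: is_id_fun_def)
        have "?F' z l * ?Q z = (?F z i * ?F' z l) * z j - (?F z j * ?F' z l) * z i"
          by (simp add: algebra_simps)
        also have "\<dots> = ?F z l * (?F' z i * z j) - ?F z l * (?F' z j * z i)"
          using s ij by simp
        finally show "?F' z l * ?Q z = 0" using t by simp
      qed
      then show "?F y i * y j = ?F y j * y i" by simp
    qed
  qed
  then show ?thesis by (simp add: bir_ord_le_def)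
qed

section \<open>Open sets of the Euclidean topology\<close>

lemma openin_bir_topology:
  fixes U :: "(nat \<times> 'k::{comm_ring_1, topological_space} coeffs) set set"
  shows "openin (bir_topology n) U \<longleftrightarrow> U \<subseteq> Bir n \<and>
     (\<forall>d\<ge>1. openin (subtopology (coeff_top n d) (Hset n d)) {c \<in> Hset n d. psi n d c \<in> U})"
proof -
  \<comment> \<open>\<open>topology\<close> recovers the given predicate only if that predicate is a
    topology; here this holds because preimages under \<open>psi\<close> commute with intersections
    and unions.\<close>
  have "istopology (\<lambda>U :: (nat \<times> 'k coeffs) set set. U \<subseteq> Bir n \<and>
     (\<forall>d\<ge>1. openin (subtopology (coeff_top n d) (Hset n d)) {c \<in> Hset n d. psi n d c \<in> U}))"
    (is "istopology ?P")
    unfolding istopology_def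
  proof (intro conjI allI impI)
    fix S T assume "?P S" "?P T"
    moreover have "{c \<in> Hset n d. psi n d c \<in> S \<inter> T}
      = {c \<in> Hset n d. psi n d c \<in> S} \<inter> {c \<in> Hset n d. psi n d c \<in> T}" for d by blast
    ultimately show "S \<inter> T \<subseteq> Bir n"
      "\<And>d. 1 \<le> d \<Longrightarrow> openin (subtopology (coeff_top n d) (Hset n d)) {c \<in> Hset n d. psi n d c \<in> S \<inter> T}"
      by auto
  next
    fix K assume K: "\<forall>U\<in>K. ?P U"
    have "{c \<in> Hset n d. psi n d c \<in> \<Union> K} = (\<Union>U\<in>K. {c \<in> Hset n d. psi n d c \<in> U})" for d
      by blast
    then show "\<Union> K \<subseteq> Bir n"
      "\<And>d. 1 \<le> d \<Longrightarrow> openin (subtopology (coeff_top n d) (Hset n d)) {c \<in> Hset n d. psi n d c \<in> \<Union> K}"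
      using K by auto
  qed
  from topology_inverse'[OF this] show ?thesis unfolding bir_topology_def by simp
qed

section \<open>Limits in a topological field\<close>

context
  assumes local_field: "local_field TYPE('k::{field_char_0, t2_space})"
begin

text \<open>Continuity of the field operations is a hypothesis here and not a type class, so the
  limit laws are derived from it.\<close>

lemma lf_tendsto_add:
  fixes f g :: "'i \<Rightarrow> 'k"
  assumes "(f \<longlongrightarrow> a) F" "(g \<longlongrightarrow> b) F" shows "((\<lambda>x. f x + g x) \<longlongrightarrow> a + b) F"
proof -
  have "continuous_on UNIV (\<lambda>p::'k \<times> 'k. fst p + snd p)"
    using local_field by (simp add: local_field_def)
  then have "isCont (\<lambda>p::'k \<times> 'k. fst p + snd p) (a, b)"
    by (simp add: continuous_on_eq_continuous_at)
  from isCont_tendsto_compose[OF this tendsto_Pair[OF assms]] show ?thesis by simp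
qed

lemma lf_tendsto_mult:
  fixes f g :: "'i \<Rightarrow> 'k"
  assumes "(f \<longlongrightarrow> a) F" "(g \<longlongrightarrow> b) F" shows "((\<lambda>x. f x * g x) \<longlongrightarrow> a * b) F"
proof -
  have "continuous_on UNIV (\<lambda>p::'k \<times> 'k. fst p * snd p)"
    using local_field by (simp add: local_field_def)
  then have "isCont (\<lambda>p::'k \<times> 'k. fst p * snd p) (a, b)"
    by (simp add: continuous_on_eq_continuous_at)
  from isCont_tendsto_compose[OF this tendsto_Pair[OF assms]] show ?thesis by simp
qed

lemma lf_tendsto_diff:
  fixes f g :: "'i \<Rightarrow> 'k"
  assumes "(f \<longlongrightarrow> a) F" "(g \<longlongrightarrow> b) F" shows "((\<lambda>x. f x - g x) \<longlongrightarrow> a - b) F"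
  using lf_tendsto_add[OF assms(1) lf_tendsto_mult[OF tendsto_const[of "-1"] assms(2)]] by simp

lemma lf_tendsto_inverse:
  fixes f :: "'i \<Rightarrow> 'k"
  assumes "(f \<longlongrightarrow> a) F" "a \<noteq> 0" shows "((\<lambda>x. inverse (f x)) \<longlongrightarrow> inverse a) F"
proof -
  have "continuous_on (UNIV - {0}) (\<lambda>x::'k. inverse x)"
    using local_field by (simp add: local_field_def)
  then have "isCont (\<lambda>x::'k. inverse x) a"
    using assms(2) by (simp add: continuous_on_eq_continuous_at open_delete)
  from isCont_tendsto_compose[OF this assms(1)] show ?thesis .
qed

lemma lf_tendsto_divide:
  fixes f g :: "'i \<Rightarrow> 'k"
  assumes "(f \<longlongrightarrow> a) F" "(g \<longlongrightarrow> b) F" "b \<noteq> 0" shows "((\<lambda>x. f x / g x) \<longlongrightarrow> a / b) F"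
  unfolding divide_inverse using assms by (intro lf_tendsto_mult lf_tendsto_inverse)

lemma lf_tendsto_sum:
  fixes f :: "'b \<Rightarrow> 'i \<Rightarrow> 'k"
  assumes "\<And>a. a \<in> A \<Longrightarrow> (f a \<longlongrightarrow> l a) F"
  shows "((\<lambda>x. \<Sum>a\<in>A. f a x) \<longlongrightarrow> (\<Sum>a\<in>A. l a)) F"
  using assms by (induction A rule: infinite_finite_induct) (auto intro: lf_tendsto_add)

lemma lf_tendsto_prod:
  fixes f :: "'b \<Rightarrow> 'i \<Rightarrow> 'k"
  assumes "\<And>a. a \<in> A \<Longrightarrow> (f a \<longlongrightarrow> l a) F"
  shows "((\<lambda>x. \<Prod>a\<in>A. f a x) \<longlongrightarrow> (\<Prod>a\<in>A. l a)) F"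
  using assms by (induction A rule: infinite_finite_induct) (auto intro: lf_tendsto_mult)

lemma lf_tendsto_power:
  fixes f :: "'i \<Rightarrow> 'k"
  shows "(f \<longlongrightarrow> a) F \<Longrightarrow> ((\<lambda>x. f x ^ k) \<longlongrightarrow> a ^ k) F"
  by (induction k) (auto intro: lf_tendsto_mult)

lemma lf_tendsto_peval:
  fixes C :: "'i \<Rightarrow> 'k coeffs"
  assumes "\<And>\<alpha>. \<alpha> \<in> mons n d \<Longrightarrow> ((\<lambda>x. C x (i, \<alpha>)) \<longlongrightarrow> c (i, \<alpha>)) F"
    and "\<And>j. j \<le> n \<Longrightarrow> ((\<lambda>x. Y x j) \<longlongrightarrow> y j) F"
  shows "((\<lambda>x. peval n d (C x) i (Y x)) \<longlongrightarrow> peval n d c i y) F"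
  unfolding peval_def
  using assms by (intro lf_tendsto_sum lf_tendsto_mult lf_tendsto_prod lf_tendsto_power) auto

lemma lf_tendsto_iterate:
  fixes C :: "'i \<Rightarrow> 'k coeffs"
  assumes "\<And>i \<alpha>. i \<le> n \<Longrightarrow> \<alpha> \<in> mons n d \<Longrightarrow> ((\<lambda>x. C x (i, \<alpha>)) \<longlongrightarrow> c (i, \<alpha>)) F"
    and "i \<le> n"
  shows "((\<lambda>x. (pmap n d (C x) ^^ k) y i) \<longlongrightarrow> (pmap n d c ^^ k) y i) F"
  using assms(2)
proof (induction k arbitrary: i)
  case (Suc k)
  then show ?case
    using assms(1)
    by (auto simp: pmap_iterate_Suc simp del: funpow.simps intro!: lf_tendsto_peval)
qed simp

section \<open>Linear combinations with convergent coefficients\<close>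

text \<open>For \<open>L = UNIV\<close> and \<open>L = {0}\<close> membership in \<open>combs F L B v\<close> plays the role of the
  relations \<open>w = O(v)\<close> and \<open>w = o(v)\<close>; no absolute value on the field is needed.\<close>
definition combs :: "'i filter \<Rightarrow> 'k set \<Rightarrow> 'b set \<Rightarrow> ('b \<Rightarrow> 'i \<Rightarrow> 'k) \<Rightarrow> ('i \<Rightarrow> 'k) set" where
  "combs F L B v = {w. \<exists>s. (\<forall>b\<in>B. \<exists>l\<in>L. (s b \<longlongrightarrow> l) F) \<and>
     (\<forall>\<^sub>F x in F. w x = (\<Sum>b\<in>B. s b x * v b x))}"

lemma combsI:
  assumes "\<And>b. b \<in> B \<Longrightarrow> \<exists>l\<in>L. (s b \<longlongrightarrow> l) F" "\<forall>\<^sub>F x in F. w x = (\<Sum>b\<in>B. s b x * v b x)"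
  shows "w \<in> combs F L B v"
  using assms unfolding combs_def by blast

lemma combsE:
  assumes "w \<in> combs F L B v"
  obtains s where "\<forall>b\<in>B. \<exists>l\<in>L. (s b \<longlongrightarrow> l) F" "\<forall>\<^sub>F x in F. w x = (\<Sum>b\<in>B. s b x * v b x)"
  using assms unfolding combs_def by blast

lemma combs_mono: "w \<in> combs F L B v \<Longrightarrow> L \<subseteq> L' \<Longrightarrow> w \<in> combs F L' B v"
  unfolding combs_def by blast

lemma combs_cong:
  assumes "w \<in> combs F L B v" "\<forall>\<^sub>F x in F. w' x = w x" shows "w' \<in> combs F L B v"
proof -
  obtain s where s: "\<forall>b\<in>B. \<exists>l\<in>L. (s b \<longlongrightarrow> l) F" "\<forall>\<^sub>F x in F. w x = (\<Sum>b\<in>B. s b x * v b x)"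
    by (rule combsE[OF assms(1)])
  show ?thesis
  proof (rule combsI)
    show "\<exists>l\<in>L. (s b \<longlongrightarrow> l) F" if "b \<in> B" for b using s(1) that by blast
    show "\<forall>\<^sub>F x in F. w' x = (\<Sum>b\<in>B. s b x * v b x)" using s(2) assms(2) by eventually_elim simp
  qed
qed

lemma combs_base:
  assumes "finite B" "b \<in> B" shows "v b \<in> combs F UNIV B v"
proof (rule combsI)
  show "\<exists>l\<in>UNIV. ((\<lambda>x. if a = b then 1 else 0) \<longlongrightarrow> l) F" for a by (auto intro: tendsto_const)
  show "\<forall>\<^sub>F x in F. v b x = (\<Sum>a\<in>B. (if a = b then 1 else 0) * v a x)"
    using assms by (simp add: if_distrib[of "\<lambda>c. c * _"] cong: if_cong)
qed

lemma combs_zero: "0 \<in> L \<Longrightarrow> (\<lambda>x. 0) \<in> combs F L B v"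
  by (rule combsI[where s = "\<lambda>b x. 0"]) (auto intro!: bexI[of _ 0])

lemma combs_add:
  assumes "w \<in> combs F L B v" "w' \<in> combs F L B v" and L: "\<And>a b. a \<in> L \<Longrightarrow> b \<in> L \<Longrightarrow> a + b \<in> L"
  shows "(\<lambda>x. w x + w' x) \<in> combs F L B v"
proof -
  obtain s where s: "\<forall>b\<in>B. \<exists>l\<in>L. (s b \<longlongrightarrow> l) F" "\<forall>\<^sub>F x in F. w x = (\<Sum>b\<in>B. s b x * v b x)"
    by (rule combsE[OF assms(1)])
  obtain t where t: "\<forall>b\<in>B. \<exists>l\<in>L. (t b \<longlongrightarrow> l) F" "\<forall>\<^sub>F x in F. w' x = (\<Sum>b\<in>B. t b x * v b x)"
    by (rule combsE[OF assms(2)])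
  show ?thesis
  proof (rule combsI)
    fix b assume "b \<in> B"
    then obtain l m where "l \<in> L" "(s b \<longlongrightarrow> l) F" "m \<in> L" "(t b \<longlongrightarrow> m) F" using s(1) t(1) by blast
    then show "\<exists>l\<in>L. ((\<lambda>x. s b x + t b x) \<longlongrightarrow> l) F" using lf_tendsto_add L by blast
  next
    show "\<forall>\<^sub>F x in F. w x + w' x = (\<Sum>b\<in>B. (s b x + t b x) * v b x)"
      using s(2) t(2) by eventually_elim (simp add: distrib_right sum.distrib)
  qed
qed

text \<open>Two sets \<open>L\<close> and \<open>L'\<close> occur because a multiplier that tends to
  0 turns O(v) into o(v).\<close>

lemma combs_mult:
  assumes "w \<in> combs F L B v" "(a \<longlongrightarrow> m) F" and L: "\<And>l. l \<in> L \<Longrightarrow> m * l \<in> L'"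
  shows "(\<lambda>x. a x * w x) \<in> combs F L' B v"
proof -
  obtain s where s: "\<forall>b\<in>B. \<exists>l\<in>L. (s b \<longlongrightarrow> l) F" "\<forall>\<^sub>F x in F. w x = (\<Sum>b\<in>B. s b x * v b x)"
    by (rule combsE[OF assms(1)])
  show ?thesis
  proof (rule combsI)
    fix b assume "b \<in> B"
    then obtain l where "l \<in> L" "(s b \<longlongrightarrow> l) F" using s(1) by blast
    then show "\<exists>l\<in>L'. ((\<lambda>x. a x * s b x) \<longlongrightarrow> l) F" using lf_tendsto_mult[OF assms(2)] L by blast
  next
    show "\<forall>\<^sub>F x in F. a x * w x = (\<Sum>b\<in>B. (a x * s b x) * v b x)"
      using s(2) by eventually_elim (simp add: sum_distrib_left mult.assoc)
  qed
qed

lemma combs_diff: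
  assumes "w \<in> combs F L B v" "w' \<in> combs F L B v" and L: "L = UNIV \<or> L = {0}"
  shows "(\<lambda>x. w x - w' x) \<in> combs F L B v"
proof -
  have "(\<lambda>x. - 1 * w' x) \<in> combs F L B v"
    using assms(2) by (rule combs_mult[OF _ tendsto_const]) (use L in auto)
  from combs_add[OF assms(1) this] L show ?thesis by auto
qed

lemma combs_sum:
  assumes "\<And>a. a \<in> A \<Longrightarrow> w a \<in> combs F L B v" and L: "L = UNIV \<or> L = {0}"
  shows "(\<lambda>x. \<Sum>a\<in>A. w a x) \<in> combs F L B v"
  using assms(1)
proof (induction A rule: infinite_finite_induct)
  case (insert a A)
  have "(\<lambda>x. w a x + (\<Sum>a\<in>A. w a x)) \<in> combs F L B v"
    using insert by (intro combs_add) (use L in auto)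
  then show ?case using insert by simp
qed (use L in \<open>auto intro: combs_zero\<close>)

text \<open>These are the rules O(O(v')) = O(v') and o(O(v')) = o(v').\<close>

lemma combs_trans:
  assumes "w \<in> combs F L B v" "\<And>b. b \<in> B \<Longrightarrow> v b \<in> combs F UNIV B' v'" and L: "L = UNIV \<or> L = {0}"
  shows "w \<in> combs F L B' v'"
proof -
  obtain s where s: "\<forall>b\<in>B. \<exists>l\<in>L. (s b \<longlongrightarrow> l) F" "\<forall>\<^sub>F x in F. w x = (\<Sum>b\<in>B. s b x * v b x)"
    by (rule combsE[OF assms(1)])
  have "(\<lambda>x. s b x * v b x) \<in> combs F L B' v'" if b: "b \<in> B" for b
  proof -
    obtain l where l: "l \<in> L" "(s b \<longlongrightarrow> l) F" using s(1) b by blast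
    show ?thesis using L l by (intro combs_mult[OF assms(2)[OF b] l(2)]) auto
  qed
  then have "(\<lambda>x. \<Sum>b\<in>B. s b x * v b x) \<in> combs F L B' v'" using L by (rule combs_sum)
  then show ?thesis using s(2) by (rule combs_cong)
qed

text \<open>Nakayama's lemma for the local ring of germs of convergent families.\<close>
lemma combs_nakayama:
  assumes "finite B" "\<And>a. a \<in> B \<Longrightarrow> v a \<in> combs F {0} B v" "a \<in> B"
  shows "\<forall>\<^sub>F x in F. v a x = 0"
  using assms
proof (induction B arbitrary: a)
  case (insert b B)
  obtain s where s: "\<And>a. a \<in> insert b B \<Longrightarrow> (s a \<longlongrightarrow> 0) F"
      "\<forall>\<^sub>F x in F. v b x = (\<Sum>a\<in>insert b B. s a x * v a x)"
    by (rule combsE[OF insert.prems(1)[of b]]) auto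
  \<comment> \<open>Since \<open>1 - s b x\<close> tends to 1 it is eventually invertible, so the
    relation can be solved for \<open>v b\<close>, and the remaining coefficients still tend to
    0.\<close>
  have lim: "((\<lambda>x. 1 - s b x) \<longlongrightarrow> 1) F"
    using lf_tendsto_diff[OF tendsto_const[of 1] s(1)[of b]] by simp
  have ne: "\<forall>\<^sub>F x in F. 1 - s b x \<noteq> 0"
    using tendsto_imp_eventually_ne[OF lim, of 0] by simp
  have vb: "v b \<in> combs F {0} B v"
  proof (rule combsI)
    fix a assume "a \<in> B"
    then show "\<exists>l\<in>{0}. ((\<lambda>x. s a x / (1 - s b x)) \<longlongrightarrow> l) F"
      using lf_tendsto_divide[OF s(1)[of a] lim] by simp
  next
    show "\<forall>\<^sub>F x in F. v b x = (\<Sum>a\<in>B. s a x / (1 - s b x) * v a x)"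
      using ne s(2)
    proof eventually_elim
      case (elim x)
      have "(1 - s b x) * v b x = (\<Sum>a\<in>B. s a x * v a x)"
        using elim(2) insert.hyps by (simp add: algebra_simps)
      then have "v b x = (\<Sum>a\<in>B. s a x * v a x) / (1 - s b x)"
        using elim(1) by (simp add: field_simps)
      then show ?case by (simp add: sum_divide_distrib)
    qed
  qed
  have base: "v c \<in> combs F UNIV B v" if "c \<in> insert b B" for c
    using that combs_base[OF insert.hyps(1)] combs_mono[OF vb] by auto
  \<comment> \<open>Substituting for \<open>v b\<close> in the other relations keeps their
    coefficients null, so the induction hypothesis applies to \<open>B\<close>.\<close>
  have zero: "\<forall>\<^sub>F x in F. v a x = 0" if "a \<in> B" for a
    using combs_trans[OF insert.prems(1) base] that by (intro insert.IH) auto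
  moreover have "\<forall>\<^sub>F x in F. v b x = 0"
  proof -
    obtain t where t: "\<forall>\<^sub>F x in F. v b x = (\<Sum>a\<in>B. t a x * v a x)" by (rule combsE[OF vb])
    have "\<forall>\<^sub>F x in F. \<forall>a\<in>B. v a x = 0"
      using zero insert.hyps(1) by (intro eventually_ball_finite) auto
    then show ?thesis using t by eventually_elim simp
  qed
  ultimately show ?case using insert.prems by blast
qed simp

section \<open>Lipschitz estimates for polynomial expressions\<close>

lemma combs_diff_mult:
  assumes "(\<lambda>x. A x - A' x) \<in> combs F UNIV B v" "(\<lambda>x. C x - C' x) \<in> combs F UNIV B v"
    and "(A \<longlongrightarrow> a) F" "(C' \<longlongrightarrow> c) F"
  shows "(\<lambda>x. A x * C x - A' x * C' x) \<in> combs F UNIV B v"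
proof -
  have "(\<lambda>x. A x * (C x - C' x) + C' x * (A x - A' x)) \<in> combs F UNIV B v"
    using assms by (intro combs_add combs_mult[where a = A] combs_mult[where a = C']) auto
  then show ?thesis by (simp add: algebra_simps)
qed

lemma combs_diff_power:
  assumes "(\<lambda>x. A x - A' x) \<in> combs F UNIV B v" "(A \<longlongrightarrow> a) F" "(A' \<longlongrightarrow> a') F"
  shows "(\<lambda>x. A x ^ k - A' x ^ k) \<in> combs F UNIV B v"
proof (induction k)
  case (Suc k)
  then show ?case
    using combs_diff_mult[OF assms(1) Suc assms(2) lf_tendsto_power[OF assms(3)]] by simp
qed (simp add: combs_zero)

lemma combs_diff_prod:
  assumes "\<And>j. j \<in> J \<Longrightarrow> (\<lambda>x. A j x - A' j x) \<in> combs F UNIV B v"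
    and "\<And>j. j \<in> J \<Longrightarrow> (A j \<longlongrightarrow> a j) F" "\<And>j. j \<in> J \<Longrightarrow> (A' j \<longlongrightarrow> a' j) F"
  shows "(\<lambda>x. (\<Prod>j\<in>J. A j x) - (\<Prod>j\<in>J. A' j x)) \<in> combs F UNIV B v"
  using assms
proof (induction J rule: infinite_finite_induct)
  case (insert i J)
  have "(\<lambda>x. A i x * (\<Prod>j\<in>J. A j x) - A' i x * (\<Prod>j\<in>J. A' j x)) \<in> combs F UNIV B v"
    using insert by (intro combs_diff_mult[where a = "a i" and c = "\<Prod>j\<in>J. a' j"] lf_tendsto_prod) auto
  then show ?case using insert by simp
qed (simp_all add: combs_zero)

text \<open>Each monomial is Lipschitz along convergent families, and its coefficient in
  \<open>E\<close> tends to 0. This is the precise form of small difference quotients.\<close>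

lemma combs_diff_peval:
  assumes "\<And>j. j \<le> n \<Longrightarrow> (\<lambda>x. Y x j - Y' x j) \<in> combs F UNIV B v"
    and "\<And>j. j \<le> n \<Longrightarrow> ((\<lambda>x. Y x j) \<longlongrightarrow> y j) F" "\<And>j. j \<le> n \<Longrightarrow> ((\<lambda>x. Y' x j) \<longlongrightarrow> y' j) F"
    and E: "\<And>\<alpha>. \<alpha> \<in> mons n d \<Longrightarrow> ((\<lambda>x. E x (i, \<alpha>)) \<longlongrightarrow> 0) F"
  shows "(\<lambda>x. peval n d (E x) i (Y x) - peval n d (E x) i (Y' x)) \<in> combs F {0} B v"
proof -
  have "(\<lambda>x. \<Sum>\<alpha>\<in>mons n d. E x (i, \<alpha>) * ((\<Prod>j\<le>n. Y x j ^ \<alpha> j) - (\<Prod>j\<le>n. Y' x j ^ \<alpha> j)))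
    \<in> combs F {0} B v"
  proof (rule combs_sum)
    fix \<alpha> assume \<alpha>: "\<alpha> \<in> mons n d"
    have "(\<lambda>x. (\<Prod>j\<le>n. Y x j ^ \<alpha> j) - (\<Prod>j\<le>n. Y' x j ^ \<alpha> j)) \<in> combs F UNIV B v"
      using assms(1-3)
      by (intro combs_diff_prod[where a = "\<lambda>j. y j ^ \<alpha> j" and a' = "\<lambda>j. y' j ^ \<alpha> j"]
          combs_diff_power lf_tendsto_power) auto
    from combs_mult[OF this E[OF \<alpha>]]
    show "(\<lambda>x. E x (i, \<alpha>) * ((\<Prod>j\<le>n. Y x j ^ \<alpha> j) - (\<Prod>j\<le>n. Y' x j ^ \<alpha> j))) \<in> combs F {0} B v"
      by simp
  qed simp
  then show ?thesis by (simp add: peval_def right_diff_distrib sum_subtractf)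
qed

section \<open>Maps of finite order close to the identity\<close>

text \<open>The last condition on \<open>p\<close> keeps it off the zero set of the common factor of
  the limit tuple. The limit map then fixes \<open>p\<close>, so each of the finitely many orbit
  points tends to \<open>p\<close> and the denominators are eventually nonzero.\<close>

lemma eventually_fixes_point:
  fixes C :: "'i \<Rightarrow> 'k coeffs" and p :: "nat \<Rightarrow> 'k"
  assumes lim: "\<And>i \<alpha>. i \<le> n \<Longrightarrow> \<alpha> \<in> mons n d \<Longrightarrow> ((\<lambda>x. C x (i, \<alpha>)) \<longlongrightarrow> c (i, \<alpha>)) F"
    and id: "\<And>y i j. i \<le> n \<Longrightarrow> j \<le> n \<Longrightarrow> peval n d c i y * y j = peval n d c j y * y i"
    and i: "i \<le> n" "p i \<noteq> 0" "peval n d c i p \<noteq> 0"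
    and k: "0 < k" and triv: "\<forall>\<^sub>F x in F. iterate_trivial n d (C x) k"
  shows "\<forall>\<^sub>F x in F. \<forall>a\<le>n. peval n d (C x) a p * p i = peval n d (C x) i p * p a"
proof -
  \<comment> \<open>This is the map in the affine chart \<open>y i = p i\<close>; normalising to
    \<open>p i\<close> instead of 1 puts \<open>p\<close> itself in the chart.\<close>
  define step where "step c' y = (\<lambda>a. p i * peval n d c' a y / peval n d c' i y)" for c' y
  define Y where "Y m x = (step (C x) ^^ m) p" for m x
  define D where "D m a x = Y (Suc m) x a - Y m x a" for m a x
  have Y0: "Y 0 x = p" for x by (simp add: Y_def)
  have YS: "Y (Suc m) x a = p i * peval n d (C x) a (Y m x) / peval n d (C x) i (Y m x)" for m x a
    by (simp add: Y_def step_def)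
  have Ylim: "((\<lambda>x. Y m x a) \<longlongrightarrow> p a) F" if "a \<le> n" for m a
    using that
  proof (induction m arbitrary: a)
    case 0 then show ?case by (simp add: Y0)
  next
    case (Suc m)
    have "((\<lambda>x. p i * peval n d (C x) a (Y m x) / peval n d (C x) i (Y m x))
      \<longlongrightarrow> p i * peval n d c a p / peval n d c i p) F"
      using Suc i lim by (intro lf_tendsto_divide lf_tendsto_mult tendsto_const lf_tendsto_peval) auto
    moreover have "p i * peval n d c a p / peval n d c i p = p a"
      using id[OF Suc.prems i(1), of p] i by (simp add: field_simps)
    ultimately show ?case by (simp add: YS)
  qed
  have Plim: "((\<lambda>x. peval n d (C x) a (Y m x)) \<longlongrightarrow> peval n d c a p) F" if "a \<le> n" for m a
    using that lim Ylim by (intro lf_tendsto_peval) auto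
  have ne: "\<forall>\<^sub>F x in F. peval n d (C x) i (Y m x) \<noteq> 0" for m
    using tendsto_imp_eventually_ne[OF Plim[OF i(1)]] i(3) by blast
  have Yi: "\<forall>\<^sub>F x in F. Y m x i = p i" for m
  proof (cases m)
    case (Suc l)
    show ?thesis using ne[of l] by eventually_elim (simp add: YS Suc)
  qed (simp add: Y0)

  have D_Suc: "(\<lambda>x. D (Suc m) a x - D m a x) \<in> combs F {0} {..n} (D m)" if a: "a \<le> n" for m a
  proof -
    define E where "E x j = C x j - c j" for x j
    define G where "G y x = p i * peval n d (E x) a y - y a * peval n d (E x) i y" for y x
    have Elim: "((\<lambda>x. E x (b, \<alpha>)) \<longlongrightarrow> 0) F" if "b \<le> n" "\<alpha> \<in> mons n d" for b \<alpha>
      using lf_tendsto_diff[OF lim[OF that] tendsto_const[of "c (b, \<alpha>)"]] by (simp add: E_def)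
    have Ediff: "peval n d (E x) b y = peval n d (C x) b y - peval n d c b y" for x b y
      by (simp add: peval_def E_def left_diff_distrib sum_subtractf)
    \<comment> \<open>The limit map contributes nothing to the displacement, so only \<open>E\<close> enters.\<close>
    have DG: "\<forall>\<^sub>F x in F. D l a x = G (Y l x) x / peval n d (C x) i (Y l x)" for l
      using Yi[of l] ne[of l]
    proof eventually_elim
      case (elim x)
      have "p i * peval n d c a (Y l x) = Y l x a * peval n d c i (Y l x)"
        using id[OF a i(1), of "Y l x"] elim(1) by (simp add: mult.commute)
      then have "G (Y l x) x = p i * peval n d (C x) a (Y l x) - Y l x a * peval n d (C x) i (Y l x)"
        by (simp add: G_def Ediff algebra_simps)
      then show ?case using elim(2) by (simp add: D_def YS diff_divide_distrib)
    qed
    have Dbase: "(\<lambda>x. Y (Suc m) x b - Y m x b) \<in> combs F UNIV {..n} (D m)" if "b \<le> n" for b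
      using combs_base[of "{..n}" b "D m" F] that by (simp add: D_def[abs_def])
    have Pdiff: "(\<lambda>x. peval n d (E x) b (Y (Suc m) x) - peval n d (E x) b (Y m x)) \<in> combs F {0} {..n} (D m)"
      if "b \<le> n" for b
      using that Dbase Ylim Elim by (intro combs_diff_peval[where y = p and y' = p]) auto
    have Ei0: "((\<lambda>x. peval n d (E x) i (Y m x)) \<longlongrightarrow> 0) F"
      using lf_tendsto_peval[of n d E i "\<lambda>_. 0" F "Y m" p] Elim[OF i(1)] Ylim by (simp add: peval_def)
    \<comment> \<open>The change of \<open>G\<close> along one step, with its second product split
      by the Leibniz rule: differences of \<open>E\<close> are o(\<open>D m\<close>), and the
      remaining displacement carries the null factor \<open>E_i\<close>.\<close>
    have "(\<lambda>x. p i * (peval n d (E x) a (Y (Suc m) x) - peval n d (E x) a (Y m x))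
        - (Y (Suc m) x a * (peval n d (E x) i (Y (Suc m) x) - peval n d (E x) i (Y m x))
          + peval n d (E x) i (Y m x) * (Y (Suc m) x a - Y m x a))) \<in> combs F {0} {..n} (D m)"
      by (intro combs_diff combs_add combs_mult[OF Pdiff[OF a] tendsto_const]
          combs_mult[OF Pdiff[OF i(1)] Ylim[OF a]] combs_mult[OF Dbase[OF a] Ei0]) auto
    then have "(\<lambda>x. G (Y (Suc m) x) x - G (Y m x) x) \<in> combs F {0} {..n} (D m)"
      by (simp add: G_def algebra_simps)
    moreover have "((\<lambda>x. inverse (peval n d (C x) i (Y (Suc m) x))) \<longlongrightarrow> inverse (peval n d c i p)) F"
      using Plim[OF i(1)] i(3) by (rule lf_tendsto_inverse)
    ultimately have 1: "(\<lambda>x. inverse (peval n d (C x) i (Y (Suc m) x)) * (G (Y (Suc m) x) x - G (Y m x) x))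
        \<in> combs F {0} {..n} (D m)"
      by (rule combs_mult) simp
    \<comment> \<open>The other source of error is the change of denominator. It multiplies the old
      displacement by a relative change that tends to 0, since both denominators have the same
      limit.\<close>
    have "((\<lambda>x. (peval n d (C x) i (Y m x) - peval n d (C x) i (Y (Suc m) x)) / peval n d (C x) i (Y (Suc m) x))
      \<longlongrightarrow> (peval n d c i p - peval n d c i p) / peval n d c i p) F"
      using Plim[OF i(1)] i(3) by (intro lf_tendsto_divide lf_tendsto_diff)
    from combs_mult[OF Dbase[OF a] this]
    have 2: "(\<lambda>x. (peval n d (C x) i (Y m x) - peval n d (C x) i (Y (Suc m) x)) / peval n d (C x) i (Y (Suc m) x)
        * (Y (Suc m) x a - Y m x a)) \<in> combs F {0} {..n} (D m)" by simp
    show ?thesis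
    proof (rule combs_cong[OF combs_add[OF 1 2]])
      show "\<forall>\<^sub>F x in F. D (Suc m) a x - D m a x =
          inverse (peval n d (C x) i (Y (Suc m) x)) * (G (Y (Suc m) x) x - G (Y m x) x)
        + (peval n d (C x) i (Y m x) - peval n d (C x) i (Y (Suc m) x)) / peval n d (C x) i (Y (Suc m) x)
        * (Y (Suc m) x a - Y m x a)"
        using DG[of m] DG[of "Suc m"] ne[of m] ne[of "Suc m"]
      proof eventually_elim
        case (elim x)
        define P where "P = peval n d (C x) i (Y m x)"
        define P' where "P' = peval n d (C x) i (Y (Suc m) x)"
        have "P \<noteq> 0" "P' \<noteq> 0" using elim by (simp_all add: P_def P'_def)
        then have "G (Y (Suc m) x) x / P' - G (Y m x) x / P =
            inverse P' * (G (Y (Suc m) x) x - G (Y m x) x) + (P - P') / P' * (G (Y m x) x / P)"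
          by (simp add: field_simps)
        then show ?case
          using elim(1,2) unfolding D_def[of m, symmetric] P_def[symmetric] P'_def[symmetric] by simp
      qed
    qed simp
  qed
  have D_all: "(\<lambda>x. D m a x - D 0 a x) \<in> combs F {0} {..n} (D 0)" if "a \<le> n" for m a
    using that
  proof (induction m arbitrary: a)
    case 0 then show ?case by (simp add: combs_zero)
  next
    case (Suc m)
    \<comment> \<open>By induction \<open>D m\<close> is O(\<open>D 0\<close>), so an error
      o(\<open>D m\<close>) is also o(\<open>D 0\<close>) and the steps can be added up.\<close>
    have "D m b \<in> combs F UNIV {..n} (D 0)" if "b \<le> n" for b
      using combs_add[OF combs_mono[OF Suc.IH[OF that]] combs_base[of "{..n}" b "D 0"]] that by auto
    then have "(\<lambda>x. D (Suc m) a x - D m a x) \<in> combs F {0} {..n} (D 0)"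
      by (intro combs_trans[OF D_Suc[OF Suc.prems]]) auto
    from combs_add[OF this Suc.IH[OF Suc.prems]] show ?case by simp
  qed

  have closed: "\<forall>\<^sub>F x in F. \<forall>a\<le>n. Y k x a = p a"
  proof -
    have "\<forall>\<^sub>F x in F. \<forall>m\<in>{..<k}. peval n d (C x) i (Y m x) \<noteq> 0"
      using ne by (intro eventually_ball_finite) auto
    then show ?thesis using triv Yi[of k]
    proof eventually_elim
      case (elim x)
      \<comment> \<open>The iterates of \<open>pmap\<close> are not normalised, so they follow the
        orbit \<open>Y\<close> only up to a scalar; nonzero denominators keep that scalar
        nonzero.\<close>
      have "\<exists>s. s \<noteq> 0 \<and> (\<forall>a\<le>n. (pmap n d (C x) ^^ m) p a = s * Y m x a)" if "m \<le> k" for m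
        using that
      proof (induction m)
        case 0 then show ?case by (auto simp: Y0 intro: exI[of _ 1])
      next
        case (Suc m)
        then obtain s where s: "s \<noteq> 0" "\<And>a. a \<le> n \<Longrightarrow> (pmap n d (C x) ^^ m) p a = s * Y m x a" by auto
        have P: "peval n d (C x) i (Y m x) \<noteq> 0" using elim(1) Suc.prems by auto
        have "peval n d (C x) a ((pmap n d (C x) ^^ m) p) = s ^ d * peval n d (C x) a (Y m x)" for a
          using s(2) by (rule peval_scale_cong)
        then show ?case
          using s(1) P i(2)
          by (intro exI[of _ "s ^ d * peval n d (C x) i (Y m x) / p i"])
             (auto simp: pmap_iterate_Suc YS simp del: funpow.simps)
      qed
      then obtain s where s: "s \<noteq> 0" "\<And>a. a \<le> n \<Longrightarrow> (pmap n d (C x) ^^ k) p a = s * Y k x a"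
        by blast
      have "s * Y k x a * p i = s * Y k x i * p a" if "a \<le> n" for a
        using elim(2) i(1) that s(2) unfolding iterate_trivial_def by metis
      then show ?case using s(1) i(2) elim(3) by auto
    qed
  qed
  \<comment> \<open>The displacements along the closed orbit sum to \<open>0\<close> and all agree with the first one
    up to \<open>o\<close> of it.\<close>
  have "D 0 a \<in> combs F {0} {..n} (D 0)" if a: "a \<le> n" for a
  proof -
    have "(\<lambda>x. \<Sum>m<k. D m a x - D 0 a x) \<in> combs F {0} {..n} (D 0)"
      using D_all[OF a] by (intro combs_sum) auto
    \<comment> \<open>As the orbit closes up, the sum of the differences is
      \<open>- k * D 0 a\<close>; characteristic zero allows division by \<open>- k\<close>.\<close>
    from combs_mult[OF this tendsto_const[of "- 1 / of_nat k"]]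
    have "(\<lambda>x. - 1 / of_nat k * (\<Sum>m<k. D m a x - D 0 a x)) \<in> combs F {0} {..n} (D 0)" by simp
    then show ?thesis
    proof (rule combs_cong)
      show "\<forall>\<^sub>F x in F. D 0 a x = - 1 / of_nat k * (\<Sum>m<k. D m a x - D 0 a x)"
        using closed
      proof eventually_elim
        case (elim x)
        have "(\<Sum>m<k. D m a x) = Y k x a - Y 0 x a"
          unfolding D_def by (rule sum_lessThan_telescope)
        then show ?case using elim a k by (simp add: Y0 sum_subtractf)
      qed
    qed
  qed
  then have "\<forall>\<^sub>F x in F. D 0 a x = 0" if "a \<in> {..n}" for a
    using that by (intro combs_nakayama[of "{..n}"]) auto
  then have "\<forall>\<^sub>F x in F. \<forall>a\<in>{..n}. D 0 a x = 0" by (intro eventually_ball_finite) auto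
  then show ?thesis using ne[of 0]
    by eventually_elim (auto simp: D_def YS Y0 field_simps)
qed

lemma eventually_identity:
  fixes C :: "'i \<Rightarrow> 'k coeffs"
  assumes lim: "\<And>i \<alpha>. i \<le> n \<Longrightarrow> \<alpha> \<in> mons n d \<Longrightarrow> ((\<lambda>x. C x (i, \<alpha>)) \<longlongrightarrow> c (i, \<alpha>)) F"
    and id: "\<And>y i j. i \<le> n \<Longrightarrow> j \<le> n \<Longrightarrow> peval n d c i y * y j = peval n d c j y * y i"
    and i: "i \<le> n" "peval n d c i q \<noteq> 0" and k: "0 < k"
  shows "\<forall>\<^sub>F x in F. iterate_trivial n d (C x) k \<longrightarrow>
    (\<forall>y a b. a \<le> n \<longrightarrow> b \<le> n \<longrightarrow> peval n d (C x) a y * y b = peval n d (C x) b y * y a)"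
proof -
  \<comment> \<open>Restricting the filter turns triviality of the iterate into an eventual
    property. If no such tuples are near, \<open>G\<close> is the trivial filter and nothing is
    lost.\<close>
  define G where "G = inf F (principal {x. iterate_trivial n d (C x) k})"
  have limG: "((\<lambda>x. C x (i, \<alpha>)) \<longlongrightarrow> c (i, \<alpha>)) G" if "i \<le> n" "\<alpha> \<in> mons n d" for i \<alpha>
    using lim[OF that] unfolding G_def by (rule tendsto_mono[rotated]) simp
  have trivG: "\<forall>\<^sub>F x in G. iterate_trivial n d (C x) k"
    unfolding G_def by (simp add: eventually_inf_principal)
  \<comment> \<open>The degree of \<open>R\<close> below: \<open>1 + d\<close> from its first
    factor, \<open>d + 1\<close> from the second. It does not depend on \<open>x\<close>, so one
    grid serves all tuples.\<close>
  define N where "N = (1 + d) + (d + 1)"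
  define A :: "'k set" where "A = of_nat ` {..N}"
  have cardA: "card A > N" unfolding A_def by (subst card_image) (auto simp: inj_on_def)
  \<comment> \<open>The first factor vanishes exactly at the points where
    \<open>eventually_fixes_point\<close> does not apply, so the grid need not avoid them.\<close>
  define R where "R x a y = (y i * peval n d c i y) * (peval n d (C x) a y * y i - peval n d (C x) i y * y a)"
    for x a y
  have R: "polyfun n N (R x a)" if "a \<le> n" for x a
    unfolding R_def N_def using that i(1)
    by (intro polyfun_mult polyfun_diff polyfun_coord polyfun_peval)
  have "\<forall>\<^sub>F x in G. \<forall>a\<le>n. R x a p = 0" for p
  proof (cases "p i = 0 \<or> peval n d c i p = 0")
    case False
    then have "\<forall>\<^sub>F x in G. \<forall>a\<le>n. peval n d (C x) a p * p i = peval n d (C x) i p * p a"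
      using eventually_fixes_point[OF limG id i(1) _ _ k trivG] by blast
    then show ?thesis by eventually_elim (simp add: R_def)
  qed (auto simp: R_def)
  then have "\<forall>\<^sub>F x in G. \<forall>p\<in>PiE {..n} (\<lambda>_. A). \<forall>a\<le>n. R x a p = 0"
    by (intro eventually_ball_finite finite_PiE) (auto simp: A_def)
  then have "\<forall>\<^sub>F x in G.
    \<forall>y a b. a \<le> n \<longrightarrow> b \<le> n \<longrightarrow> peval n d (C x) a y * y b = peval n d (C x) b y * y a"
  proof eventually_elim
    case (elim x)
    have R0: "R x a y = 0" if a: "a \<le> n" for a y
    proof (rule polyfun_zero_on_grid[OF R[OF a] cardA])
      fix y :: "nat \<Rightarrow> 'k" assume "\<And>j. j \<le> n \<Longrightarrow> y j \<in> A"
      then have "restrict y {..n} \<in> PiE {..n} (\<lambda>_. A)" by auto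
      then have "R x a (restrict y {..n}) = 0" using elim a by blast
      moreover have "R x a y = R x a (restrict y {..n})" by (rule polyfun_cong[OF R[OF a]]) simp
      ultimately show "R x a y = 0" by simp
    qed
    let ?P = "\<lambda>y. y i * peval n d c i y"
    have P: "polyfun n (1 + d) ?P"
      using i(1) by (intro polyfun_mult polyfun_coord polyfun_peval)
    obtain z where z: "?P z \<noteq> 0"
      using polyfun_mult_nonzero[OF polyfun_coord[OF i(1)] _ polyfun_peval i(2), of "\<lambda>_. 1"] by auto
    show ?case
    proof (intro allI impI)
      fix y :: "nat \<Rightarrow> 'k" and a b assume ab: "a \<le> n" "b \<le> n"
      let ?Q = "\<lambda>y. peval n d (C x) a y * y b - peval n d (C x) b y * y a"
      have "?Q y = 0"
      proof (rule polyfun_cancel[where P = ?P and Q = ?Q, OF P z])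
        show "polyfun n (d + 1) ?Q"
          using ab by (intro polyfun_mult polyfun_diff polyfun_coord polyfun_peval)
        fix w
        have e: "peval n d (C x) l w * w i = peval n d (C x) i w * w l \<or> ?P w = 0" if "l \<le> n" for l
          using R0[OF that, of w] by (auto simp: R_def)
        show "?P w * ?Q w = 0"
        \<comment> \<open>Where the factor is nonzero, multiplying by \<open>w i\<close> reduces the
          relation between \<open>a\<close> and \<open>b\<close> to their relations with the pivot
          \<open>i\<close>.\<close>
        proof (cases "?P w = 0")
          case False
          have "w i * ?Q w = (peval n d (C x) a w * w i) * w b - (peval n d (C x) b w * w i) * w a"
            by (simp add: algebra_simps)
          also have "\<dots> = 0" using e[OF ab(1)] e[OF ab(2)] False by simp
          finally show ?thesis by auto
        qed simp
      qed
      then show "peval n d (C x) a y * y b = peval n d (C x) b y * y a" by simp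
    qed
  qed
  then show ?thesis by (simp add: G_def eventually_inf_principal)
qed

section \<open>The identity is isolated among maps of bounded order\<close>

text \<open>Only the exponents in \<open>{0<..D}\<close> matter, so each may have its own
  neighbourhood. Near a representative of the identity it comes from
  \<open>eventually_identity\<close>; elsewhere a failing equation for the \<open>k\<close>-th
  iterate persists by continuity.\<close>

lemma openin_id_or_large_order:
  "openin (bir_topology n) {f \<in> Bir n. f = bir_id n \<or> \<not> bir_ord_le n (f :: (nat \<times> 'k coeffs) set) D}"
    (is "openin _ ?U")
  unfolding openin_bir_topology
proof (intro conjI allI impI)
  fix d :: nat assume d: "d \<ge> 1"
  let ?X = "subtopology (coeff_top n d) (Hset n d) :: 'k coeffs topology"
  let ?V = "{c \<in> Hset n d. psi n d c \<in> ?U}"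
  have top: "topspace ?X = Hset n d" by (auto simp: coeff_top_def Hset_def)
  have "\<exists>T. openin ?X T \<and> c \<in> T \<and> T \<subseteq> ?V" if "c \<in> ?V" for c
  proof -
    have c: "c \<in> Hset n d" using that by simp
    define F where "F = nhdsin ?X c"
    have inH: "\<forall>\<^sub>F x in F. x \<in> Hset n d"
      unfolding F_def eventually_nhdsin using top c openin_topspace[of ?X] by auto
    have lim: "((\<lambda>x. x (i, \<alpha>)) \<longlongrightarrow> c (i, \<alpha>)) F" if "i \<le> n" "\<alpha> \<in> mons n d" for i \<alpha>
    proof (rule topological_tendstoI)
      fix S :: "'k set" assume S: "open S" "c (i, \<alpha>) \<in> S"
      have "continuous_map ?X euclidean (\<lambda>x. x (i, \<alpha>))"
        unfolding coeff_top_def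
        by (intro continuous_map_from_subtopology continuous_map_product_projection)
           (use that in \<open>auto simp: idx_def\<close>)
      then have "openin ?X {x \<in> topspace ?X. x (i, \<alpha>) \<in> S}"
        using S(1) by (auto simp: continuous_map_def)
      then show "\<forall>\<^sub>F x in F. x (i, \<alpha>) \<in> S"
        unfolding F_def eventually_nhdsin using S(2) c top by blast
    qed
    have "\<forall>\<^sub>F x in F. \<forall>k\<in>{0<..D}. iterate_trivial n d x k \<longrightarrow> psi n d x = bir_id n"
    proof (intro eventually_ball_finite ballI)
      fix k assume k: "k \<in> {0<..D}"
      show "\<forall>\<^sub>F x in F. iterate_trivial n d x k \<longrightarrow> psi n d x = bir_id n"
      proof (cases "psi n d c = bir_id n")
        case True
        then have id: "peval n d c i y * y j = peval n d c j y * y i" if "i \<le> n" "j \<le> n" for y i j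
          using psi_eq_bir_id_iff[OF d c] that by blast
        obtain q i where i: "i \<le> n" "peval n d c i q \<noteq> 0" by (rule Hset_nonzero[OF c])
        have "\<forall>\<^sub>F x in F. iterate_trivial n d x k \<longrightarrow>
            (\<forall>y a b. a \<le> n \<longrightarrow> b \<le> n \<longrightarrow> peval n d x a y * y b = peval n d x b y * y a)"
          using k by (intro eventually_identity[OF lim id i]) auto
        then show ?thesis using inH
          by eventually_elim (simp add: psi_eq_bir_id_iff[OF d])
      next
        case False
        then have "\<not> iterate_trivial n d c k"
          using that k bir_ord_le_psi_iff[OF d c, of D] by auto
        then obtain y i j where ij: "i \<le> n" "j \<le> n"
            and ne: "(pmap n d c ^^ k) y i * y j - (pmap n d c ^^ k) y j * y i \<noteq> 0"
          by (auto simp: iterate_trivial_def)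
        have "((\<lambda>x. (pmap n d x ^^ k) y i * y j - (pmap n d x ^^ k) y j * y i)
            \<longlongrightarrow> (pmap n d c ^^ k) y i * y j - (pmap n d c ^^ k) y j * y i) F"
          using lim ij by (intro lf_tendsto_diff lf_tendsto_mult tendsto_const lf_tendsto_iterate) auto
        from tendsto_imp_eventually_ne[OF this ne]
        have "\<forall>\<^sub>F x in F. \<not> iterate_trivial n d x k"
          by eventually_elim (use ij in \<open>auto simp: iterate_trivial_def\<close>)
        then show ?thesis by eventually_elim simp
      qed
    qed simp
    then have "\<forall>\<^sub>F x in F. x \<in> ?V"
      using inH by eventually_elim (use d in \<open>auto simp: bir_ord_le_psi_iff Bir_def\<close>)
    then show ?thesis unfolding F_def eventually_nhdsin using c top by auto
  qed
  then show "openin ?X ?V" by (subst openin_subopen) blast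
qed auto

end

theorem theorem1p1:
  fixes f :: "nat \<Rightarrow> (nat \<times> ('k::{field_char_0, t2_space}) coeffs) set"
    and n D :: nat
  assumes "local_field TYPE('k)"
    and "n \<ge> 2" and "D \<ge> 2"
    and "\<And>m. f m \<in> Bir n"
    and "eventually (\<lambda>m. bir_ord_le n (f m) D) sequentially"
    and "limitin (bir_topology n) f (bir_id n) sequentially"
  shows "eventually (\<lambda>m. f m = bir_id n) sequentially"
proof -
  let ?U = "{g \<in> Bir n. g = bir_id n \<or> \<not> bir_ord_le n (g :: (nat \<times> 'k coeffs) set) D}"
  have U: "openin (bir_topology n) ?U" by (rule openin_id_or_large_order[OF assms(1)])
  \<comment> \<open>Convergence already places the limit in the topspace, so
    \<open>bir_id n \<in> Bir n\<close> follows without checking that \<open>id_coeffs\<close> is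
    birational.\<close>
  have "bir_id n \<in> topspace (bir_topology n :: (nat \<times> 'k coeffs) set topology)"
    using assms(6) by (simp add: limitin_def)
  then have "(bir_id n :: (nat \<times> 'k coeffs) set) \<in> Bir n"
    using openin_bir_topology[of n "topspace (bir_topology n)"] by auto
  then have "bir_id n \<in> ?U" by simp
  then have "\<forall>\<^sub>F m in sequentially. f m \<in> ?U"
    using assms(6) U unfolding limitin_def by blast
  then show ?thesis using assms(5) by eventually_elim auto
qed

end
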